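(* Let $G$ be a compact Lie group, let $X$ be a $G$-space, and let $pr_1^X, pr_2^X\colon X\times X\to X$ be the coordinate projections, where $X\times X$ carries the diagonal $G$-action. Then $$\mathrm{TC}_G(X)=D_G(pr_1^X,pr_2^X).$$
   Context: $\simeq_G$ denotes $G$-homotopy. Equivariant homotopic distance: for $G$-maps $f,g\colon X\to Y$, $D_G(f,g)$ is the least integer $n\ge 0$ such that $X$ has an open cover $\{U_0,\dots,U_n\}$ by $G$-invariant open sets with $f|_{U_i}\simeq_G g|_{U_i}$ for all $0\le i\le n$; it is $\infty$ if no such $n$ exists. Equivariant sectional category: for a $G$-map $p\colon E\to B$, $\mathrm{secat}_G(p)$ is the least integer $n\ge 0$ such that $B$ has a cover by $n+1$ $G$-invariant open subsets $U_0,\dots,U_n$ and, for each $i$, a $G$-map $s_i\colon U_i\to E$ with $p\circ s_i\simeq_G \mathrm{inc}_{U_i}$ (inclusion $U_i\hookrightarrow B$); it is $\infty$ if no such $n$ exists. Equivariant topological complexity: $\mathrm{TC}_G(X)=\mathrm{secat}_G(\pi_X)$, where $\pi_X\colon X^I\to X\times X$, $\pi_X(\gamma)=(\gamma(0),\gamma(1))$, is the path fibration on $X$, $X^I$ having the action $(g\gamma)(t)=g\gamma(t)$. *)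

theory Defs
  imports "HOL-Analysis.Analysis" "HOL-Algebra.Group_Action" "HOL-Library.Extended_Nat"
begin

section \<open>Compact Lie groups\<close>

text \<open>
  The dimension of a Lie group may be any natural number (finite groups have dimension 0), so
  charts take values in \<^const>\<open>Euclidean_space\<close> n, whose points are the sequences vanishing
  from index n on, and not in a type of class \<^class>\<open>euclidean_space\<close>, which has positive
  dimension.
\<close>

definition partial_deriv :: "nat \<Rightarrow> ((nat \<Rightarrow> real) \<Rightarrow> real) \<Rightarrow> (nat \<Rightarrow> real) \<Rightarrow> real" where
  "partial_deriv i f x = deriv (\<lambda>t. f (x(i := t))) (x i)"

text \<open>
  Continuous differentiability of order k on an open subset W of n-space. Since W is open, only
  the values of f on W matter.
\<close>

primrec Ck_on :: "nat \<Rightarrow> nat \<Rightarrow> (nat \<Rightarrow> real) set \<Rightarrow> ((nat \<Rightarrow> real) \<Rightarrow> real) \<Rightarrow> bool" where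
  "Ck_on 0 n W f \<longleftrightarrow> continuous_map (subtopology (Euclidean_space n) W) euclideanreal f"
| "Ck_on (Suc k) n W f \<longleftrightarrow>
     continuous_map (subtopology (Euclidean_space n) W) euclideanreal f \<and>
     (\<forall>i<n. (\<forall>x\<in>W. (\<lambda>t. f (x(i := t))) field_differentiable at (x i)) \<and>
             Ck_on k n W (partial_deriv i f))"

definition smooth_map ::
  "nat \<Rightarrow> (nat \<Rightarrow> real) set \<Rightarrow> nat \<Rightarrow> ((nat \<Rightarrow> real) \<Rightarrow> nat \<Rightarrow> real) \<Rightarrow> bool" where
  "smooth_map n W m F \<longleftrightarrow>
     openin (Euclidean_space n) W \<and> F ` W \<subseteq> topspace (Euclidean_space m) \<and>
     (\<forall>j<m. \<forall>k. Ck_on k n W (\<lambda>x. F x j))"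

type_synonym 'g chart = "'g set \<times> ('g \<Rightarrow> nat \<Rightarrow> real)"

definition is_chart :: "nat \<Rightarrow> 'g topology \<Rightarrow> 'g chart \<Rightarrow> bool" where
  "is_chart n T c \<longleftrightarrow> (case c of (U, \<phi>) \<Rightarrow>
     openin T U \<and> openin (Euclidean_space n) (\<phi> ` U) \<and>
     homeomorphic_map (subtopology T U) (subtopology (Euclidean_space n) (\<phi> ` U)) \<phi>)"

definition smooth_atlas :: "nat \<Rightarrow> 'g topology \<Rightarrow> 'g chart set \<Rightarrow> bool" where
  "smooth_atlas n T A \<longleftrightarrow>
     (\<forall>c\<in>A. is_chart n T c) \<and> (\<Union>c\<in>A. fst c) = topspace T \<and>
     (\<forall>(U, \<phi>)\<in>A. \<forall>(V, \<psi>)\<in>A. smooth_map n (\<phi> ` (U \<inter> V)) n (\<psi> \<circ> inv_into U \<phi>))"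

text \<open>Coordinates in 2n-space of a pair of points of n-space: the first and the last n entries.\<close>

definition fst_coords :: "nat \<Rightarrow> (nat \<Rightarrow> real) \<Rightarrow> nat \<Rightarrow> real" where
  "fst_coords n z = (\<lambda>i. if i < n then z i else 0)"

definition snd_coords :: "nat \<Rightarrow> (nat \<Rightarrow> real) \<Rightarrow> nat \<Rightarrow> real" where
  "snd_coords n z = (\<lambda>i. if i < n then z (n + i) else 0)"

text \<open>
  A Lie group of dimension n with smooth structure given by the atlas A. Multiplication and
  inversion are continuous, and smooth in the charts of A.
\<close>

locale lie_group = group G for G :: "('g, 'm) monoid_scheme" (structure) +
  fixes T :: "'g topology" and n :: nat and A :: "'g chart set"
  assumes topspace_eq: "topspace T = carrier G"
    and hausdorff: "Hausdorff_space T"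
    and second_countable: "second_countable T"
    and atlas: "smooth_atlas n T A"
    and continuous_mult: "continuous_map (prod_topology T T) T (\<lambda>(x, y). x \<otimes> y)"
    and continuous_inv: "continuous_map T T (\<lambda>x. inv x)"
    and smooth_mult: "\<And>U \<phi> V \<psi> W \<theta>. \<lbrakk>(U, \<phi>) \<in> A; (V, \<psi>) \<in> A; (W, \<theta>) \<in> A\<rbrakk> \<Longrightarrow>
      smooth_map (n + n)
        {z \<in> topspace (Euclidean_space (n + n)).
           fst_coords n z \<in> \<phi> ` U \<and> snd_coords n z \<in> \<psi> ` V \<and>
           inv_into U \<phi> (fst_coords n z) \<otimes> inv_into V \<psi> (snd_coords n z) \<in> W}
        n (\<lambda>z. \<theta> (inv_into U \<phi> (fst_coords n z) \<otimes> inv_into V \<psi> (snd_coords n z)))"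
    and smooth_inv: "\<And>U \<phi> W \<theta>. \<lbrakk>(U, \<phi>) \<in> A; (W, \<theta>) \<in> A\<rbrakk> \<Longrightarrow>
      smooth_map n {z \<in> \<phi> ` U. inv (inv_into U \<phi> z) \<in> W} n (\<lambda>z. \<theta> (inv (inv_into U \<phi> z)))"

locale compact_lie_group = lie_group +
  assumes compact: "compact_space T"

section \<open>Spaces with a group action\<close>

definition G_space ::
  "('g, 'm) monoid_scheme \<Rightarrow> 'g topology \<Rightarrow> 'x topology \<Rightarrow> ('g \<Rightarrow> 'x \<Rightarrow> 'x) \<Rightarrow> bool" where
  "G_space G T X \<alpha> \<longleftrightarrow>
     group_action G (topspace X) \<alpha> \<and>
     continuous_map (prod_topology T X) X (\<lambda>(g, x). \<alpha> g x)"

definition invariant_set ::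
  "('g, 'm) monoid_scheme \<Rightarrow> ('g \<Rightarrow> 'x \<Rightarrow> 'x) \<Rightarrow> 'x set \<Rightarrow> bool" where
  "invariant_set G \<alpha> U \<longleftrightarrow> (\<forall>g\<in>carrier G. \<forall>x\<in>U. \<alpha> g x \<in> U)"

definition equivariant ::
  "('g, 'm) monoid_scheme \<Rightarrow> 'x set \<Rightarrow> ('g \<Rightarrow> 'x \<Rightarrow> 'x) \<Rightarrow> ('g \<Rightarrow> 'y \<Rightarrow> 'y) \<Rightarrow> ('x \<Rightarrow> 'y) \<Rightarrow> bool" where
  "equivariant G S \<alpha> \<beta> f \<longleftrightarrow> (\<forall>g\<in>carrier G. \<forall>x\<in>S. f (\<alpha> g x) = \<beta> g (f x))"

definition G_map ::
  "('g, 'm) monoid_scheme \<Rightarrow> 'x topology \<Rightarrow> ('g \<Rightarrow> 'x \<Rightarrow> 'x) \<Rightarrow> 'y topology \<Rightarrow> ('g \<Rightarrow> 'y \<Rightarrow> 'y)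
     \<Rightarrow> ('x \<Rightarrow> 'y) \<Rightarrow> bool" where
  "G_map G X \<alpha> Y \<beta> f \<longleftrightarrow> continuous_map X Y f \<and> equivariant G (topspace X) \<alpha> \<beta> f"

text \<open>
  A homotopy that is equivariant for the trivial action on the interval is the same as a homotopy
  all of whose stages are equivariant.
\<close>

definition G_homotopic ::
  "('g, 'm) monoid_scheme \<Rightarrow> 'x topology \<Rightarrow> ('g \<Rightarrow> 'x \<Rightarrow> 'x) \<Rightarrow> 'y topology \<Rightarrow> ('g \<Rightarrow> 'y \<Rightarrow> 'y)
     \<Rightarrow> ('x \<Rightarrow> 'y) \<Rightarrow> ('x \<Rightarrow> 'y) \<Rightarrow> bool" where
  "G_homotopic G X \<alpha> Y \<beta> f g \<longleftrightarrow> homotopic_with (equivariant G (topspace X) \<alpha> \<beta>) X Y f g"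

text \<open>
  The actions below are restricted to the underlying sets because the bijections in
  \<^const>\<open>BijGroup\<close>, hence in \<^const>\<open>group_action\<close>, are extensional.
\<close>

definition diagonal_action :: "'x topology \<Rightarrow> ('g \<Rightarrow> 'x \<Rightarrow> 'x) \<Rightarrow> 'g \<Rightarrow> 'x \<times> 'x \<Rightarrow> 'x \<times> 'x" where
  "diagonal_action X \<alpha> g = (\<lambda>(x, y) \<in> topspace X \<times> topspace X. (\<alpha> g x, \<alpha> g y))"

definition path_set :: "'x topology \<Rightarrow> (real \<Rightarrow> 'x) set" where
  "path_set X = {\<gamma> \<in> extensional {0..1}. pathin X \<gamma>}"

text \<open>The free path space, with the compact-open topology.\<close>

definition path_space :: "'x topology \<Rightarrow> (real \<Rightarrow> 'x) topology" where
  "path_space X = topology_generated_by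
     {{\<gamma> \<in> path_set X. \<gamma> ` K \<subseteq> V} | K V. compactin (top_of_set {0..1}) K \<and> openin X V}"

definition path_action :: "'x topology \<Rightarrow> ('g \<Rightarrow> 'x \<Rightarrow> 'x) \<Rightarrow> 'g \<Rightarrow> (real \<Rightarrow> 'x) \<Rightarrow> real \<Rightarrow> 'x" where
  "path_action X \<alpha> g = (\<lambda>\<gamma> \<in> path_set X. \<lambda>t \<in> {0..1}. \<alpha> g (\<gamma> t))"

definition path_fibration :: "(real \<Rightarrow> 'x) \<Rightarrow> 'x \<times> 'x" where
  "path_fibration \<gamma> = (\<gamma> 0, \<gamma> 1)"

section \<open>Homotopic distance, sectional category, topological complexity\<close>

text \<open>The infimum of the empty set in \<^typ>\<open>enat\<close> is \<open>\<infinity>\<close>.\<close>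

definition homotopic_distance ::
  "('g, 'm) monoid_scheme \<Rightarrow> 'x topology \<Rightarrow> ('g \<Rightarrow> 'x \<Rightarrow> 'x) \<Rightarrow> 'y topology \<Rightarrow> ('g \<Rightarrow> 'y \<Rightarrow> 'y)
     \<Rightarrow> ('x \<Rightarrow> 'y) \<Rightarrow> ('x \<Rightarrow> 'y) \<Rightarrow> enat" where
  "homotopic_distance G X \<alpha> Y \<beta> f g = Inf {enat n | n. \<exists>U :: nat \<Rightarrow> 'x set.
     (\<Union>i\<le>n. U i) = topspace X \<and>
     (\<forall>i\<le>n. openin X (U i) \<and> invariant_set G \<alpha> (U i) \<and>
        G_homotopic G (subtopology X (U i)) \<alpha> Y \<beta> f g)}"

definition secat ::
  "('g, 'm) monoid_scheme \<Rightarrow> 'e topology \<Rightarrow> ('g \<Rightarrow> 'e \<Rightarrow> 'e) \<Rightarrow> 'b topology \<Rightarrow> ('g \<Rightarrow> 'b \<Rightarrow> 'b)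
     \<Rightarrow> ('e \<Rightarrow> 'b) \<Rightarrow> enat" where
  "secat G E \<epsilon> B \<beta> p = Inf {enat n | n. \<exists>U :: nat \<Rightarrow> 'b set.
     (\<Union>i\<le>n. U i) = topspace B \<and>
     (\<forall>i\<le>n. openin B (U i) \<and> invariant_set G \<beta> (U i) \<and>
        (\<exists>s. G_map G (subtopology B (U i)) \<beta> E \<epsilon> s \<and>
             G_homotopic G (subtopology B (U i)) \<beta> B \<beta> (p \<circ> s) id))}"

definition topological_complexity ::
  "('g, 'm) monoid_scheme \<Rightarrow> 'x topology \<Rightarrow> ('g \<Rightarrow> 'x \<Rightarrow> 'x) \<Rightarrow> enat" where
  "topological_complexity G X \<alpha> =
     secat G (path_space X) (path_action X \<alpha>) (prod_topology X X) (diagonal_action X \<alpha>)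
       path_fibration"

end

theory Submission
  imports Defs
begin

text \<open>
  A homotopy \<open>h : I \<times> Z \<rightarrow> X\<close> from \<open>f\<close> to \<open>g\<close> and a map \<open>s : Z \<rightarrow> X\<^sup>I\<close> with \<open>s z\<close> a path from
  \<open>f z\<close> to \<open>g z\<close> are the same thing, by the exponential law, and \<open>h\<close> is equivariant at every
  stage exactly when \<open>s\<close> is equivariant for the pointwise action on paths. For an
  invariant set \<open>Z\<close> of pairs and the two projections, such an \<open>s\<close> is a strict equivariant section
  of the path fibration over \<open>Z\<close>. Hence an equivariant homotopy between the projections on \<open>Z\<close>
  gives a section over \<open>Z\<close>.

  Conversely, let \<open>s\<close> be a section only up to equivariant homotopy. Running along the paths
  \<open>s z\<close> joins \<open>fst \<circ> path_fibration \<circ> s\<close> to \<open>snd \<circ> path_fibration \<circ> s\<close>, and composing the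
  homotopy \<open>path_fibration \<circ> s \<simeq> id\<close> with the projections identifies these two maps with \<open>fst\<close>
  and \<open>snd\<close>. So the open covers admitted by the two invariants are the same
  (lemma \<open>G_section_iff_projections_G_homotopic\<close>), and so are their minimal sizes.

  The two halves of the exponential law each use one property of the unit interval: currying is
  continuous because compact subsets satisfy the tube lemma, and evaluation is continuous because
  the interval is locally compact.
\<close>

section \<open>The exponential law for the path space\<close>

lemma topspace_path_space [simp]: "topspace (path_space X) = path_set X"
proof
  show "topspace (path_space X) \<subseteq> path_set X"
    unfolding path_space_def by auto
  have "{\<gamma> \<in> path_set X. \<gamma> ` {} \<subseteq> {}} \<subseteq> topspace (path_space X)"
    unfolding path_space_def topology_generated_by_topspace
    by (rule Union_upper) (use compactin_empty openin_empty in blast)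
  then show "path_set X \<subseteq> topspace (path_space X)"
    by simp
qed

text \<open>
  If \<open>h (_, z)\<close> maps a compact \<open>K\<close> into an open \<open>V\<close>, the tube lemma gives a neighbourhood of
  \<open>z\<close> whose points all have this property.
\<close>

lemma continuous_map_path_space_curry:
  assumes h: "continuous_map (prod_topology (top_of_set {0..1}) Z) X h"
  shows "continuous_map Z (path_space X) (\<lambda>z. \<lambda>t\<in>{0..1}. h (t, z))" (is "continuous_map _ _ ?s")
proof -
  have path: "?s z \<in> path_set X" if "z \<in> topspace Z" for z
  proof -
    have "continuous_map (top_of_set {0..1}) (prod_topology (top_of_set {0..1}) Z) (\<lambda>t. (t, z))"
      using that by (simp add: continuous_map_paired)
    then have "continuous_map (top_of_set {0..1}) X (h \<circ> (\<lambda>t. (t, z)))"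
      using h continuous_map_compose by blast
    then have "continuous_map (top_of_set {0..1}) X (?s z)"
      by (rule continuous_map_eq) auto
    then show ?thesis
      by (auto simp: path_set_def pathin_def)
  qed
  have tube: "openin Z {z \<in> topspace Z. ?s z ` K \<subseteq> V}"
    if K: "compactin (top_of_set {0..1}) K" and V: "openin X V" for K V
  proof (subst openin_subopen, intro ballI)
    fix z assume z: "z \<in> {z \<in> topspace Z. ?s z ` K \<subseteq> V}"
    have K01: "K \<subseteq> {0..1}"
      using compactin_subset_topspace[OF K] by simp
    let ?W = "{p \<in> topspace (prod_topology (top_of_set {0..1}) Z). h p \<in> V}"
    have W: "openin (prod_topology (top_of_set {0..1}) Z) ?W"
      by (rule openin_continuous_map_preimage[OF h V])
    have "K \<times> {z} \<subseteq> ?W"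
      using z K01 by (auto simp: image_subset_iff)
    then obtain A B where AB: "openin Z B" "K \<subseteq> A" "z \<in> B" "A \<times> B \<subseteq> ?W"
      using tube_lemma_left[OF W K, of z] z by blast
    then have "B \<subseteq> {z \<in> topspace Z. ?s z ` K \<subseteq> V}"
      using K01 openin_subset[OF AB(1)] by auto
    with AB show "\<exists>T. openin Z T \<and> z \<in> T \<and> T \<subseteq> {z \<in> topspace Z. ?s z ` K \<subseteq> V}"
      by blast
  qed
  show ?thesis
    unfolding path_space_def
  proof (rule continuous_on_generated_topo)
    fix U assume "U \<in> {{\<gamma> \<in> path_set X. \<gamma> ` K \<subseteq> V} | K V.
      compactin (top_of_set {0..1}) K \<and> openin X V}"
    then obtain K V where KV: "compactin (top_of_set {0..1}) K" "openin X V"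
      and U: "U = {\<gamma> \<in> path_set X. \<gamma> ` K \<subseteq> V}"
      by blast
    have "?s -` U \<inter> topspace Z = {z \<in> topspace Z. ?s z ` K \<subseteq> V}"
      using path unfolding U by blast
    with tube[OF KV] show "openin Z (?s -` U \<inter> topspace Z)"
      by simp
  next
    have "?s ` topspace Z \<subseteq> topspace (path_space X)"
      using path by auto
    then show "?s ` topspace Z \<subseteq> \<Union> {{\<gamma> \<in> path_set X. \<gamma> ` K \<subseteq> V} | K V.
      compactin (top_of_set {0..1}) K \<and> openin X V}"
      unfolding path_space_def topology_generated_by_topspace .
  qed
qed

text \<open>
  If \<open>\<gamma> t\<close> lies in an open set \<open>V\<close>, then \<open>\<gamma>\<close> maps a compact neighbourhood \<open>K\<close> of \<open>t\<close> into \<open>V\<close>,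
  and so does every path in the subbasic open set of \<open>K\<close> and \<open>V\<close>.
\<close>

lemma continuous_map_path_evaluation:
  "continuous_map (prod_topology (top_of_set {0..1}) (path_space X)) X (\<lambda>(t, \<gamma>). \<gamma> t)"
proof -
  have cont: "continuous_map (top_of_set {0..1}) X \<gamma>" if "\<gamma> \<in> path_set X" for \<gamma>
    using that by (simp add: path_set_def pathin_def)
  have "openin (prod_topology (top_of_set {0..1}) (path_space X))
      {p \<in> {0..1} \<times> path_set X. (\<lambda>(t, \<gamma>). \<gamma> t) p \<in> V}" if V: "openin X V" for V
    unfolding openin_prod_topology_alt
  proof (intro allI impI)
    fix t :: real and \<gamma>
    assume "(t, \<gamma>) \<in> {p \<in> {0..1} \<times> path_set X. (\<lambda>(t, \<gamma>). \<gamma> t) p \<in> V}"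
    then have t: "t \<in> {0..1}" and \<gamma>: "\<gamma> \<in> path_set X" and tV: "\<gamma> t \<in> V"
      by auto
    have "openin (top_of_set {0..1}) {u \<in> {0..1}. \<gamma> u \<in> V}"
      using openin_continuous_map_preimage[OF cont[OF \<gamma>] V] by simp
    then obtain e where e: "0 < e" "cball t e \<inter> {0..1} \<subseteq> {u \<in> {0..1}. \<gamma> u \<in> V}"
      unfolding openin_contains_cball using t tV by blast
    define K where "K = cball t e \<inter> {0..1}"
    define N where "N = {\<delta> \<in> path_set X. \<delta> ` K \<subseteq> V}"
    have "compactin (top_of_set {0..1}) K"
      unfolding K_def by (simp add: compactin_subtopology compact_Int_closed)
    then have "openin (path_space X) N"
      unfolding path_space_def N_def using V by (intro topology_generated_by_Basis) blast
    moreover have "openin (top_of_set {0..1}) (ball t e \<inter> {0..1})"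
      using openin_open_Int[OF open_ball] by (subst Int_commute)
    moreover have "(ball t e \<inter> {0..1}) \<times> N \<subseteq> {p \<in> {0..1} \<times> path_set X. (\<lambda>(t, \<gamma>). \<gamma> t) p \<in> V}"
      by (auto simp: N_def K_def image_subset_iff)
    moreover have "t \<in> ball t e \<inter> {0..1}" "\<gamma> \<in> N"
      using e t \<gamma> by (auto simp: N_def K_def)
    ultimately show "\<exists>A B. openin (top_of_set {0..1}) A \<and> openin (path_space X) B \<and> t \<in> A \<and>
        \<gamma> \<in> B \<and> A \<times> B \<subseteq> {p \<in> {0..1} \<times> path_set X. (\<lambda>(t, \<gamma>). \<gamma> t) p \<in> V}"
      by blast
  qed
  moreover have "\<gamma> t \<in> topspace X" if "t \<in> {0..1}" "\<gamma> \<in> path_set X" for t \<gamma>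
    using continuous_map_image_subset_topspace[OF cont[OF that(2)]] that(1) by auto
  ultimately show ?thesis
    unfolding continuous_map_def by auto
qed

section \<open>Equivariant homotopies as equivariant maps to the path space\<close>

lemma G_homotopic_compose_left:
  assumes fg: "G_homotopic G Z \<zeta> Y \<beta> f g" and k: "G_map G Y \<beta> W \<omega> k"
  shows "G_homotopic G Z \<zeta> W \<omega> (k \<circ> f) (k \<circ> g)"
proof -
  have "homotopic_with (\<lambda>j. continuous_map Z Y j \<and> equivariant G (topspace Z) \<zeta> \<beta> j) Z Y f g"
    using fg unfolding G_homotopic_def by (rule homotopic_with_mono) simp
  then show ?thesis
    unfolding G_homotopic_def
  proof (rule homotopic_with_compose_continuous_map_left)
    show "continuous_map Y W k"
      using k by (simp add: G_map_def)
    fix j assume "continuous_map Z Y j \<and> equivariant G (topspace Z) \<zeta> \<beta> j"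
    with k show "equivariant G (topspace Z) \<zeta> \<omega> (k \<circ> j)"
      unfolding G_map_def equivariant_def using continuous_map_image_subset_topspace by fastforce
  qed
qed

lemma G_map_fst: "G_map G (prod_topology X X) (diagonal_action X \<alpha>) X \<alpha> fst"
  by (auto simp: G_map_def equivariant_def diagonal_action_def continuous_map_fst)

lemma G_map_snd: "G_map G (prod_topology X X) (diagonal_action X \<alpha>) X \<alpha> snd"
  by (auto simp: G_map_def equivariant_def diagonal_action_def continuous_map_snd)

text \<open>
  The map \<open>s\<close> is the adjoint of the homotopy. The endpoint equation holds for every \<open>z\<close> of the
  type, also outside the space, because \<^const>\<open>homotopic_with\<close> prescribes the first and the
  last stage of a homotopy as total functions.
\<close>

lemma G_homotopic_imp_G_map_path_space:
  assumes "G_homotopic G Z \<zeta> X \<alpha> f g"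
  obtains s where "G_map G Z \<zeta> (path_space X) (path_action X \<alpha>) s"
    and "\<And>z. path_fibration (s z) = (f z, g z)"
proof -
  obtain h where h: "continuous_map (prod_topology (top_of_set {0..1::real}) Z) X h"
    and h0: "\<forall>z. h (0, z) = f z" and h1: "\<forall>z. h (1, z) = g z"
    and equiv: "\<forall>t\<in>{0..1}. equivariant G (topspace Z) \<zeta> \<alpha> (\<lambda>z. h (t, z))"
    using assms unfolding G_homotopic_def homotopic_with_def by blast
  define s where "s z = (\<lambda>t\<in>{0..1}. h (t, z))" for z
  have s: "continuous_map Z (path_space X) s"
    unfolding s_def using h by (rule continuous_map_path_space_curry)
  have path: "s z \<in> path_set X" if "z \<in> topspace Z" for z
    using continuous_map_image_subset_topspace[OF s] that by auto
  have "equivariant G (topspace Z) \<zeta> (path_action X \<alpha>) s"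
    unfolding equivariant_def
  proof (intro ballI)
    fix a z assume a: "a \<in> carrier G" and z: "z \<in> topspace Z"
    have "path_action X \<alpha> a (s z) = (\<lambda>t\<in>{0..1}. \<alpha> a (h (t, z)))"
      using path[OF z] by (auto simp: path_action_def s_def)
    also have "\<dots> = s (\<zeta> a z)"
      unfolding s_def using equiv a z by (intro restrict_ext) (simp add: equivariant_def)
    finally show "s (\<zeta> a z) = path_action X \<alpha> a (s z)" ..
  qed
  with s have "G_map G Z \<zeta> (path_space X) (path_action X \<alpha>) s"
    by (simp add: G_map_def)
  moreover have "path_fibration (s z) = (f z, g z)" for z
    by (simp add: path_fibration_def s_def h0 h1)
  ultimately show thesis
    by (rule that)
qed

text \<open>
  The homotopy runs along the paths: its stage at time \<open>t\<close> is \<open>\<lambda>z. s z t\<close>, continuous by the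
  continuity of evaluation and equivariant because the group acts on paths pointwise.
\<close>

lemma G_homotopic_path_endpoints:
  assumes "G_map G Z \<zeta> (path_space X) (path_action X \<alpha>) s"
  shows "G_homotopic G Z \<zeta> X \<alpha> (fst \<circ> (path_fibration \<circ> s)) (snd \<circ> (path_fibration \<circ> s))"
proof -
  have s: "continuous_map Z (path_space X) s"
    and equiv: "equivariant G (topspace Z) \<zeta> (path_action X \<alpha>) s"
    using assms by (auto simp: G_map_def)
  have path: "s z \<in> path_set X" if "z \<in> topspace Z" for z
    using continuous_map_image_subset_topspace[OF s] that by auto
  let ?h = "(\<lambda>(t, \<gamma>). \<gamma> t) \<circ> (\<lambda>p. (fst p, s (snd p)))"
  have "continuous_map (prod_topology (top_of_set {0..1}) Z)
      (prod_topology (top_of_set {0..1}) (path_space X)) (\<lambda>p. (fst p, s (snd p)))"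
    using continuous_map_compose[OF continuous_map_snd s]
    by (simp add: continuous_map_paired continuous_map_fst o_def)
  then have "continuous_map (prod_topology (top_of_set {0..1}) Z) X ?h"
    using continuous_map_path_evaluation by (rule continuous_map_compose)
  moreover have "equivariant G (topspace Z) \<zeta> \<alpha> (\<lambda>z. ?h (t, z))" if "t \<in> {0..1}" for t
    using equiv path that by (auto simp: equivariant_def path_action_def)
  ultimately show ?thesis
    unfolding G_homotopic_def homotopic_with_def
    by (intro exI[of _ ?h]) (auto simp: path_fibration_def)
qed

section \<open>Sections of the path fibration\<close>

text \<open>
  From left to right, \<open>fst \<simeq> fst \<circ> path_fibration \<circ> s \<simeq> snd \<circ> path_fibration \<circ> s \<simeq> snd\<close>. From
  right to left, the adjoint of a homotopy from \<open>fst\<close> to \<open>snd\<close> assigns to \<open>(x, y)\<close> a path from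
  \<open>x\<close> to \<open>y\<close>, so it is a section on the nose.
\<close>

lemma G_section_iff_projections_G_homotopic:
  fixes X :: "'x topology" and U :: "('x \<times> 'x) set" and \<alpha> :: "'g \<Rightarrow> 'x \<Rightarrow> 'x"
  defines "Z \<equiv> subtopology (prod_topology X X) U" and "\<delta> \<equiv> diagonal_action X \<alpha>"
  shows "(\<exists>s. G_map G Z \<delta> (path_space X) (path_action X \<alpha>) s \<and>
            G_homotopic G Z \<delta> (prod_topology X X) \<delta> (path_fibration \<circ> s) id) \<longleftrightarrow>
         G_homotopic G Z \<delta> X \<alpha> fst snd"
proof
  assume "\<exists>s. G_map G Z \<delta> (path_space X) (path_action X \<alpha>) s \<and>
            G_homotopic G Z \<delta> (prod_topology X X) \<delta> (path_fibration \<circ> s) id"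
  then obtain s where s: "G_map G Z \<delta> (path_space X) (path_action X \<alpha>) s"
    and ps: "G_homotopic G Z \<delta> (prod_topology X X) \<delta> (path_fibration \<circ> s) id"
    by blast
  have "G_homotopic G Z \<delta> X \<alpha> (fst \<circ> (path_fibration \<circ> s)) fst"
    and "G_homotopic G Z \<delta> X \<alpha> (snd \<circ> (path_fibration \<circ> s)) snd"
    using G_homotopic_compose_left[OF ps[unfolded \<delta>_def] G_map_fst]
      G_homotopic_compose_left[OF ps[unfolded \<delta>_def] G_map_snd]
    by (simp_all add: \<delta>_def)
  with G_homotopic_path_endpoints[OF s] show "G_homotopic G Z \<delta> X \<alpha> fst snd"
    unfolding G_homotopic_def by (meson homotopic_with_symD homotopic_with_trans)
next
  assume "G_homotopic G Z \<delta> X \<alpha> fst snd"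
  then obtain s where s: "G_map G Z \<delta> (path_space X) (path_action X \<alpha>) s"
    and ps: "\<And>z. path_fibration (s z) = (fst z, snd z)"
    by (rule G_homotopic_imp_G_map_path_space) (rule that)
  have "path_fibration \<circ> s = id"
    using ps by auto
  moreover have "G_homotopic G Z \<delta> (prod_topology X X) \<delta> id id"
    unfolding G_homotopic_def
    by (simp add: equivariant_def Z_def continuous_map_from_subtopology)
  ultimately show "\<exists>s. G_map G Z \<delta> (path_space X) (path_action X \<alpha>) s \<and>
            G_homotopic G Z \<delta> (prod_topology X X) \<delta> (path_fibration \<circ> s) id"
    using s by auto
qed

theorem corollary3p4:
  fixes G :: "('g, 'm) monoid_scheme" and T :: "'g topology"
    and n :: nat and A :: "'g chart set"
    and X :: "'x topology" and \<alpha> :: "'g \<Rightarrow> 'x \<Rightarrow> 'x"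
  assumes "compact_lie_group G T n A"
    and "G_space G T X \<alpha>"
  shows "topological_complexity G X \<alpha> =
    homotopic_distance G (prod_topology X X) (diagonal_action X \<alpha>) X \<alpha> fst snd"
  unfolding topological_complexity_def secat_def homotopic_distance_def
    G_section_iff_projections_G_homotopic ..

end
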